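(* There exists a simple $5$-$(17,8,40)$ design.
   Context: A $t$-$(v,k,\lambda)$ design consists of a $v$-element set $P$ of points together with a collection $B$ of $k$-element subsets of $P$ (called blocks) such that every $t$-element subset of $P$ is contained in exactly $\lambda$ blocks. The design is simple if $B$ is a set, i.e. contains no repeated blocks. *)

theory Defs
  imports "HOL-Library.Multiset"
begin

text \<open>Blocks form a multiset, so that repeated blocks are possible and simplicity is a
  genuine condition.\<close>

definition t_design :: "nat \<Rightarrow> nat \<Rightarrow> nat \<Rightarrow> nat \<Rightarrow> 'a set \<Rightarrow> 'a set multiset \<Rightarrow> bool" where
  "t_design t v k l P B \<longleftrightarrow>
     finite P \<and> card P = v \<and>
     (\<forall>b \<in># B. b \<subseteq> P \<and> card b = k) \<and>
     (\<forall>T. T \<subseteq> P \<and> card T = t \<longrightarrow> size {# b \<in># B. T \<subseteq> b #} = l)"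

definition simple_blocks :: "'a set multiset \<Rightarrow> bool" where
  "simple_blocks B \<longleftrightarrow> (\<forall>b. count B b \<le> 1)"

end

theory Submission
  imports Defs "HOL-Number_Theory.Cong" "HOL-Computational_Algebra.Primes"
begin

text \<open>The points are the residues modulo 17, and the block set is a union of 18 orbits of
  8-subsets under the affine group \<open>x \<mapsto> a x + c\<close>, found by solving the Kramer--Mesner system of
  this group. The affine group is 2-transitive, so that only the 455 five-sets containing 0 and 1
  have to be examined. The blocks through 0 and 1 are the preimages of an orbit representative
  \<open>K\<close> under the maps \<open>x \<mapsto> (s - c) x + c\<close> with distinct \<open>c, s \<in> K\<close>; they are
  listed, freed of repetitions and counted by symbolic evaluation.\<close>

section \<open>Affine orbits of subsets of the residues modulo 17\<close>

definition affine :: "int \<Rightarrow> int \<Rightarrow> nat \<Rightarrow> nat" where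
  "affine a c x = nat ((a * int x + c) mod 17)"

text \<open>Blocks are preimages rather than images of \<open>K\<close>, so no inverse modulo 17 has
  to be computed; over all invertible maps both give the same orbit.\<close>

definition block :: "int \<Rightarrow> int \<Rightarrow> int list \<Rightarrow> nat set" where
  "block a c K = {x. x < 17 \<and> (a * int x + c) mod 17 \<in> set K}"

definition affine_orbits :: "int list list \<Rightarrow> nat set set" where
  "affine_orbits Ks = {block a c K | a c K. \<not> 17 dvd a \<and> K \<in> set Ks}"

lemma int_affine: "int (affine a c x) = (a * int x + c) mod 17"
  by (simp add: affine_def)

lemma affine_less: "affine a c x < 17"
  unfolding affine_def by (metis nat_less_iff pos_mod_bound pos_mod_sign zero_less_numeral
      nat_numeral nat_mono_iff)

lemma bij_betw_affine:
  assumes "\<not> 17 dvd a"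
  shows "bij_betw (affine a c) {..<17} {..<17}"
proof -
  have "inj_on (affine a c) {..<17}"
  proof (rule inj_onI)
    fix x y assume xy: "x \<in> {..<17::nat}" "y \<in> {..<17}" "affine a c x = affine a c y"
    have "prime (17::int)" by simp
    moreover have "(a * int x + c) mod 17 = (a * int y + c) mod 17"
      using xy(3) by (metis int_affine)
    then have "17 dvd a * (int x - int y)"
      by (simp add: mod_eq_dvd_iff right_diff_distrib)
    ultimately have "17 dvd int x - int y"
      using assms by (simp add: prime_dvd_mult_iff)
    then show "x = y"
      \<comment> \<open>A nonzero multiple of 17 has absolute value at least 17, too large for a
        difference of two residues.\<close>
      using xy(1,2) dvd_imp_le_int[of "int x - int y" 17] by (cases "x = y") auto
  qed
  moreover have "affine a c ` {..<17} \<subseteq> {..<17}"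
    using affine_less by auto
  ultimately show ?thesis
    by (simp add: bij_betw_def endo_inj_surj)
qed

lemma preimage_block:
  "{x. x < 17 \<and> affine p q x \<in> block a c K} = block (a * p) (a * q + c) K"
proof -
  have "(a * ((p * int x + q) mod 17) + c) mod 17 = (a * p * int x + (a * q + c)) mod 17" for x
  proof -
    have "(a * ((p * int x + q) mod 17) + c) mod 17 = (a * (p * int x + q) + c) mod 17"
      by (metis mod_add_left_eq mod_mult_right_eq)
    then show ?thesis by (simp add: algebra_simps)
  qed
  then show ?thesis
    by (auto simp: block_def affine_less int_affine)
qed

lemma image_preimage_affine:
  assumes "\<not> 17 dvd a" "S \<subseteq> {..<17}"
  shows "affine a c ` {x. x < 17 \<and> affine a c x \<in> S} = S"
proof
  show "S \<subseteq> affine a c ` {x. x < 17 \<and> affine a c x \<in> S}"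
  proof
    fix y assume y: "y \<in> S"
    then have "y \<in> affine a c ` {..<17}"
      using assms(2) bij_betw_imp_surj_on[OF bij_betw_affine[OF assms(1), of c]] by auto
    then obtain x where "x < 17" "y = affine a c x" by auto
    then show "y \<in> affine a c ` {x. x < 17 \<and> affine a c x \<in> S}"
      using y by simp
  qed
qed auto

lemma card_preimage_affine:
  assumes "\<not> 17 dvd a" "S \<subseteq> {..<17}"
  shows "card {x. x < 17 \<and> affine a c x \<in> S} = card S"
proof -
  have "bij_betw (affine a c) {x. x < 17 \<and> affine a c x \<in> S} S"
  proof -
    have "inj_on (affine a c) {x. x < 17 \<and> affine a c x \<in> S}"
      using bij_betw_imp_inj_on[OF bij_betw_affine[OF assms(1), of c]]
      by (rule inj_on_subset) auto
    then show ?thesis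
      using image_preimage_affine[OF assms] by (simp add: bij_betw_def)
  qed
  then show ?thesis by (rule bij_betw_same_card)
qed

text \<open>Since the entries of \<open>K\<close> are already reduced residues, \<open>nat\<close>
  is injective on them, and a block is the preimage of a set of that size under a bijection.\<close>

lemma card_block:
  assumes "\<not> 17 dvd a" "distinct K" "set K \<subseteq> {0..16}"
  shows "card (block a c K) = length K"
proof -
  have "block a c K = {x. x < 17 \<and> affine a c x \<in> nat ` set K}"
    using assms(3) by (auto simp: block_def affine_def image_iff)
      (metis atLeastAtMost_iff eq_nat_nat_iff pos_mod_sign subsetD zero_less_numeral)
  moreover have "nat ` set K \<subseteq> {..<17}"
    using assms(3) by fastforce
  ultimately have "card (block a c K) = card (nat ` set K)"
    using card_preimage_affine[OF assms(1)] by simp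
  also have "\<dots> = card (set K)"
    using assms(3) by (intro card_image inj_onI) (metis atLeastAtMost_iff eq_nat_nat_iff subsetD)
  finally show ?thesis
    using assms(2) by (simp add: distinct_card)
qed

lemma block_subset: "block a c K \<subseteq> {..<17}"
  by (auto simp: block_def)

lemma affine_orbits_subset: "affine_orbits Ks \<subseteq> Pow {..<17}"
  using block_subset by (auto simp: affine_orbits_def)

lemma finite_affine_orbits: "finite (affine_orbits Ks)"
  using affine_orbits_subset by (rule finite_subset) simp

text \<open>The affine group permutes the blocks: composing affine maps stays in the orbit, a block
  is recovered as the image of its preimage, and the family is finite.\<close>

lemma bij_betw_preimage_affine_orbits:
  assumes "\<not> 17 dvd p"
  shows "bij_betw (\<lambda>b. {x. x < 17 \<and> affine p q x \<in> b}) (affine_orbits Ks) (affine_orbits Ks)"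
proof -
  let ?f = "\<lambda>b. {x. x < 17 \<and> affine p q x \<in> b}"
  have "inj_on ?f (affine_orbits Ks)"
  proof (rule inj_onI)
    fix b b' assume b: "b \<in> affine_orbits Ks" "b' \<in> affine_orbits Ks" "?f b = ?f b'"
    have "affine p q ` ?f d = d" if "d \<in> affine_orbits Ks" for d
      using that affine_orbits_subset by (intro image_preimage_affine[OF assms]) auto
    then show "b = b'" using b by metis
  qed
  moreover have "?f ` affine_orbits Ks \<subseteq> affine_orbits Ks"
  proof
    fix d assume "d \<in> ?f ` affine_orbits Ks"
    then obtain a c K where "\<not> 17 dvd a" "K \<in> set Ks" "d = ?f (block a c K)"
      by (auto simp: affine_orbits_def)
    moreover have "\<not> 17 dvd a * p"
      using assms \<open>\<not> 17 dvd a\<close> by (simp add: prime_dvd_mult_iff)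
    ultimately show "d \<in> affine_orbits Ks"
      unfolding preimage_block affine_orbits_def by blast
  qed
  ultimately show ?thesis
    using finite_affine_orbits by (simp add: bij_betw_def endo_inj_surj)
qed

text \<open>This is 2-transitivity: pulling \<open>T\<close> and all blocks back along one affine
  map preserves containment and moves two points of \<open>T\<close> to 0 and 1.\<close>

lemma card_blocks_containing_reduce:
  assumes T: "T \<subseteq> {..<17}" "card T \<ge> 2"
  obtains T' where "T' \<subseteq> {..<17}" "card T' = card T" "0 \<in> T'" "1 \<in> T'"
    "card {b \<in> affine_orbits Ks. T \<subseteq> b} = card {b \<in> affine_orbits Ks. T' \<subseteq> b}"
proof -
  obtain x y where xy: "x \<in> T" "y \<in> T" "x \<noteq> y"
    using T(2) by (metis card_le_Suc0_iff_eq card_eq_0_iff not_less_eq_eq numeral_2_eq_2 le_0_eq nat.distinct(1))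
  \<comment> \<open>The map with these coefficients sends 0 to \<open>x\<close> and 1 to
    \<open>y\<close>.\<close>
  define p q where "p = int y - int x" and "q = int x"
  have less: "x < 17" "y < 17" using xy T(1) by auto
  have p: "\<not> 17 dvd p"
    using less xy(3) dvd_imp_le_int[of p 17] unfolding p_def by auto
  let ?f = "\<lambda>b. {x. x < 17 \<and> affine p q x \<in> b}"
  have iff: "T \<subseteq> b \<longleftrightarrow> ?f T \<subseteq> ?f b" for b
  proof
    assume "?f T \<subseteq> ?f b"
    then have "affine p q ` ?f T \<subseteq> b" by auto
    then show "T \<subseteq> b"
      using image_preimage_affine[OF p T(1)] by simp
  qed auto
  have "bij_betw ?f {b \<in> affine_orbits Ks. T \<subseteq> b} {b \<in> affine_orbits Ks. ?f T \<subseteq> b}"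
  proof (rule bij_betw_subset[OF bij_betw_preimage_affine_orbits[OF p]])
    show "{b \<in> affine_orbits Ks. T \<subseteq> b} \<subseteq> affine_orbits Ks" by blast
    have "?f ` affine_orbits Ks = affine_orbits Ks"
      using bij_betw_preimage_affine_orbits[OF p] by (rule bij_betw_imp_surj_on)
    moreover have "?f ` {b \<in> A. T \<subseteq> b} = {d \<in> ?f ` A. ?f T \<subseteq> d}" for A
      using iff by auto
    ultimately show "?f ` {b \<in> affine_orbits Ks. T \<subseteq> b} = {b \<in> affine_orbits Ks. ?f T \<subseteq> b}"
      by simp
  qed
  then have "card {b \<in> affine_orbits Ks. T \<subseteq> b} = card {b \<in> affine_orbits Ks. ?f T \<subseteq> b}"
    by (rule bij_betw_same_card)
  moreover have "affine p q 0 = x" "affine p q 1 = y"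
    using less by (auto simp: affine_def p_def q_def)
  ultimately show ?thesis
    using that[of "?f T"] xy card_preimage_affine[OF p T(1)] by auto
qed

section \<open>Counting by radix recursion on characteristic vectors\<close>

text \<open>The functions below match on explicit Boolean patterns instead of using conditionals, \<open>map\<close>
  and \<open>filter\<close>: this speeds up the simplifier by an order of magnitude.\<close>

fun drop_head :: "bool \<Rightarrow> bool list list \<Rightarrow> bool list list" where
  "drop_head c [] = []"
| "drop_head c ([] # bss) = drop_head c bss"
| "drop_head True ((True # bs) # bss) = bs # drop_head True bss"
| "drop_head True ((False # bs) # bss) = drop_head True bss"
| "drop_head False ((True # bs) # bss) = drop_head False bss"
| "drop_head False ((False # bs) # bss) = bs # drop_head False bss"

fun drop_any_head :: "bool list list \<Rightarrow> bool list list" where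
  "drop_any_head [] = []"
| "drop_any_head ([] # bss) = drop_any_head bss"
| "drop_any_head ((b # bs) # bss) = bs # drop_any_head bss"

text \<open>Vectors of length \<open>n\<close> are split by their first entry. Repetitions disappear
  only at depth 0, where any nonempty list of empty vectors collapses to a single one.\<close>

fun radix_dedup :: "nat \<Rightarrow> bool list list \<Rightarrow> bool list list" where
  "radix_dedup n [] = []"
| "radix_dedup 0 (bs # bss) = [[]]"
| "radix_dedup (Suc n) (bs # bss) =
     map (Cons True) (radix_dedup n (drop_head True (bs # bss))) @
     map (Cons False) (radix_dedup n (drop_head False (bs # bss)))"

text \<open>Tests all 0/1 vectors of length \<open>n\<close> with \<open>k\<close> ones
  simultaneously, sharing common prefixes. A zero restricts nothing, so every head is dropped; a one
  keeps only vectors starting with \<open>True\<close>. With no ones left the whole list counts;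
  with ones left but no positions there is nothing to test.\<close>

fun covers_exactly :: "nat \<Rightarrow> nat \<Rightarrow> nat \<Rightarrow> bool list list \<Rightarrow> bool" where
  "covers_exactly l n 0 bss \<longleftrightarrow> length bss = l"
| "covers_exactly l 0 (Suc k) bss \<longleftrightarrow> True"
| "covers_exactly l (Suc n) (Suc k) bss \<longleftrightarrow>
     covers_exactly l n (Suc k) (drop_any_head bss) \<and> covers_exactly l n k (drop_head True bss)"

lemma set_drop_head: "set (drop_head c bss) = {bs. c # bs \<in> set bss}"
  by (induction c bss rule: drop_head.induct) auto

lemma set_drop_any_head: "set (drop_any_head bss) = {bs. \<exists>b. b # bs \<in> set bss}"
  by (induction bss rule: drop_any_head.induct) auto

lemma radix_dedup_correct:
  assumes "\<forall>bs\<in>set bss. length bs = n"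
  shows "set (radix_dedup n bss) = set bss \<and> distinct (radix_dedup n bss)"
  using assms
proof (induction n bss rule: radix_dedup.induct)
  case (2 bs bss)
  then show ?case by auto
next
  case (3 n bs bss)
  let ?L = "bs # bss"
  have IH: "set (radix_dedup n (drop_head c ?L)) = {bs. c # bs \<in> set ?L}"
    "distinct (radix_dedup n (drop_head c ?L))" for c
    using 3 by (cases c; force simp: set_drop_head)+
  \<comment> \<open>All vectors have length \<open>Suc n\<close>, so none is empty and each has a
    first entry to split on.\<close>
  have split: "set ?L = Cons True ` {bs. True # bs \<in> set ?L} \<union> Cons False ` {bs. False # bs \<in> set ?L}"
  proof -
    have "\<exists>ds. es = True # ds \<or> es = False # ds" if "es \<in> set ?L" for es
      using 3(3) that by (cases es) auto
    then show ?thesis by blast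
  qed
  have "set (radix_dedup (Suc n) ?L) = set ?L"
    by (subst split) (simp only: radix_dedup.simps set_append set_map IH)
  moreover have "distinct (radix_dedup (Suc n) ?L)"
    using IH(2) by (auto simp: distinct_map)
  ultimately show ?case by blast
qed simp

lemma length_filter_drop_head:
  "length (filter (list_all2 (\<longrightarrow>) (True # ts)) bss) =
    length (filter (list_all2 (\<longrightarrow>) ts) (drop_head True bss))"
  by (induction "True" bss rule: drop_head.induct) auto

lemma length_filter_drop_any_head:
  "length (filter (list_all2 (\<longrightarrow>) (False # ts)) bss) =
    length (filter (list_all2 (\<longrightarrow>) ts) (drop_any_head bss))"
  by (induction bss rule: drop_any_head.induct) auto

text \<open>Soundness of the test. The relation \<open>list_all2 (\<longrightarrow>)\<close> is
  inclusion of sets written on characteristic vectors.\<close>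

lemma covers_exactly_imp_length_filter:
  assumes "covers_exactly l n k bss" "\<forall>bs\<in>set bss. length bs = n" "length ts = n"
    "count_list ts True = k"
  shows "length (filter (list_all2 (\<longrightarrow>) ts) bss) = l"
  using assms
proof (induction l n k bss arbitrary: ts rule: covers_exactly.induct)
  case (1 l n bss)
  \<comment> \<open>Here \<open>ts\<close> has no \<open>True\<close> entry, so it lies below every
    vector of its length.\<close>
  have "list_all2 (\<longrightarrow>) ts bs" if "bs \<in> set bss" for bs
    using 1 that by (auto simp: list_all2_conv_all_nth count_list_0_iff in_set_conv_nth)
  then have "filter (list_all2 (\<longrightarrow>) ts) bss = bss"
    by (simp add: filter_id_conv)
  then show ?case using 1 by simp
next
  case (3 l n k bss)
  obtain u us where ts: "ts = u # us" using 3 by (cases ts) auto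
  show ?case
  proof (cases u)
    case True
    then have "length (filter (list_all2 (\<longrightarrow>) us) (drop_head True bss)) = l"
      using 3(3-) ts by (intro 3(2)) (auto simp: set_drop_head)
    then show ?thesis
      using length_filter_drop_head ts True by simp
  next
    case False
    then have "length (filter (list_all2 (\<longrightarrow>) us) (drop_any_head bss)) = l"
      using 3(3-) ts by (intro 3(1)) (auto simp: set_drop_any_head)
    then show ?thesis
      using length_filter_drop_any_head ts False by simp
  qed
qed simp

section \<open>Blocks through 0 and 1\<close>

text \<open>Coordinates 0 and 1 are omitted because all sets to be compared contain both points;
  this leaves 15 coordinates.\<close>

definition char_vector :: "nat set \<Rightarrow> bool list" where
  "char_vector S = map (\<lambda>x. x \<in> S) [2..<17]"

definition block_vectors :: "int list list \<Rightarrow> bool list list" where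
  "block_vectors Ks =
     concat (map (\<lambda>K. concat (map (\<lambda>c. map
       (\<lambda>s. map (\<lambda>x. ((s - c) * x + c) mod 17 \<in> set K) [2..16])
       (filter (\<lambda>s. s \<noteq> c) K)) K)) Ks)"

lemma length_char_vector: "length (char_vector S) = 15"
  by (simp add: char_vector_def)

lemma list_all2_char_vector:
  assumes "S \<subseteq> {..<17}" "0 \<in> U" "1 \<in> U"
  shows "list_all2 (\<longrightarrow>) (char_vector S) (char_vector U) \<longleftrightarrow> S \<subseteq> U"
proof -
  have "list_all2 (\<longrightarrow>) (char_vector S) (char_vector U) \<longleftrightarrow>
    (\<forall>x\<in>{2..<17}. x \<in> S \<longrightarrow> x \<in> U)"
    by (simp only: char_vector_def list_all2_map1 list_all2_map2 list_all2_same set_upt)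
  moreover have "x = 0 \<or> x = 1 \<or> x \<in> {2..<17}" if "x < 17" for x :: nat
    using that by auto
  ultimately show ?thesis
    using assms by (metis lessThan_iff subset_iff)
qed

lemma count_list_char_vector:
  assumes "S \<subseteq> {..<17}" "0 \<in> S" "1 \<in> S"
  shows "count_list (char_vector S) True = card S - 2"
proof -
  have "count_list (char_vector S) True = length (filter (\<lambda>x. x \<in> S) [2..<17])"
    by (simp only: char_vector_def count_list_eq_length_filter filter_map o_def length_map
        eq_True simp_thms eq_commute[of True])
  also have "\<dots> = card (set (filter (\<lambda>x. x \<in> S) [2..<17]))"
    by (intro distinct_card[symmetric] distinct_filter distinct_upt)
  also have "set (filter (\<lambda>x. x \<in> S) [2..<17]) = S - {0, 1}"
  proof -
    have "x \<in> {2..<17} \<longleftrightarrow> x < 17 \<and> x \<noteq> 0 \<and> x \<noteq> 1" for x :: nat by auto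
    then show ?thesis using assms(1) unfolding set_filter set_upt by blast
  qed
  also have "card (S - {0, 1}) = card S - 2"
    using assms by (simp add: card_Diff_subset)
  finally show ?thesis .
qed

text \<open>Modulo 17 an affine map is determined by its values \<open>u\<close> at 0 and
  \<open>s\<close> at 1, its slope being \<open>s - u\<close>.\<close>

lemma char_vector_block:
  assumes "c mod 17 = u" "(a + c) mod 17 = s"
  shows "char_vector (block a c K) = map (\<lambda>x. ((s - u) * x + u) mod 17 \<in> set K) [2..16]"
proof -
  have "[2..16] = map int [2..<17]" by (simp add: upt_rec upto_rec1)
  moreover have "(a * z + c) mod 17 = ((s - u) * z + u) mod 17" for z
  proof -
    have "[s - u = a + c - c] (mod 17)"
      unfolding assms[symmetric] by (intro cong_diff) (auto simp: cong_def)
    then have "[(s - u) * z + u = a * z + c] (mod 17)"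
      unfolding assms(1)[symmetric] by (intro cong_add cong_mult) (auto simp: cong_def)
    then show ?thesis by (simp add: cong_def)
  qed
  ultimately show ?thesis
    by (simp add: char_vector_def block_def)
qed

text \<open>A block contains 0 and 1 exactly when its map sends both into \<open>K\<close>. These
  two values differ because the slope is invertible, and conversely any two distinct entries of
  \<open>K\<close> arise as such values.\<close>

lemma set_block_vectors:
  assumes "\<forall>K\<in>set Ks. set K \<subseteq> {0..16}"
  shows "set (block_vectors Ks) = char_vector ` {b \<in> affine_orbits Ks. 0 \<in> b \<and> 1 \<in> b}"
    (is "?L = ?R")
proof
  show "?L \<subseteq> ?R"
  proof
    fix v assume "v \<in> ?L"
    then obtain K c s where K: "K \<in> set Ks" "c \<in> set K" "s \<in> set K" "s \<noteq> c"
      and v: "v = map (\<lambda>x. ((s - c) * x + c) mod 17 \<in> set K) [2..16]"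
      by (auto simp: block_vectors_def)
    have bounds: "c \<in> {0..16}" "s \<in> {0..16}" using K assms by blast+
    then have mod: "c mod 17 = c" "(s - c + c) mod 17 = s" by auto
    have "\<not> 17 dvd s - c"
      using bounds K(4) dvd_imp_le_int[of "s - c" 17] by auto
    then have "block (s - c) c K \<in> affine_orbits Ks"
      using K by (auto simp: affine_orbits_def)
    moreover have "0 \<in> block (s - c) c K" "1 \<in> block (s - c) c K"
      using K mod by (auto simp: block_def)
    moreover have "v = char_vector (block (s - c) c K)"
      using char_vector_block[OF mod] v by simp
    ultimately show "v \<in> ?R" by blast
  qed
  show "?R \<subseteq> ?L"
  proof
    fix v assume "v \<in> ?R"
    then obtain a c K where K: "K \<in> set Ks" "\<not> 17 dvd a"
      and b: "0 \<in> block a c K" "1 \<in> block a c K" and v: "v = char_vector (block a c K)"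
      by (auto simp: affine_orbits_def)
    let ?u = "c mod 17" and ?s = "(a + c) mod 17"
    have "?u \<in> set K" "?s \<in> set K"
      using b by (auto simp: block_def)
    moreover have "?s \<noteq> ?u"
      using K(2) by (simp add: mod_eq_dvd_iff)
    ultimately show "v \<in> ?L"
      using K(1) v char_vector_block[OF refl refl, of a c K]
      by (auto simp: block_vectors_def intro!: bexI[of _ K] bexI[of _ ?u] image_eqI[of _ _ ?s])
  qed
qed

lemma card_blocks_containing:
  assumes Ks: "\<forall>K\<in>set Ks. set K \<subseteq> {0..16}"
    and cov: "covers_exactly l 15 k (radix_dedup 15 (block_vectors Ks))"
    and T: "T \<subseteq> {..<17}" "card T = k + 2"
  shows "card {b \<in> affine_orbits Ks. T \<subseteq> b} = l"
proof -
  obtain S where S: "S \<subseteq> {..<17}" "card S = card T" "0 \<in> S" "1 \<in> S"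
    and card: "card {b \<in> affine_orbits Ks. T \<subseteq> b} = card {b \<in> affine_orbits Ks. S \<subseteq> b}"
    using card_blocks_containing_reduce[OF T(1), of Ks] T(2) by auto
  let ?vs = "radix_dedup 15 (block_vectors Ks)"
  have "\<forall>v\<in>set (block_vectors Ks). length v = 15"
    by (auto simp: set_block_vectors[OF Ks] length_char_vector)
  note dedup = radix_dedup_correct[OF this]
  \<comment> \<open>Needed to count vectors instead of blocks: all these blocks contain 0 and 1, so
    equal vectors yield inclusion both ways.\<close>
  have "inj_on char_vector {b \<in> affine_orbits Ks. S \<subseteq> b}"
  proof (rule inj_onI)
    fix b d assume b: "b \<in> {b \<in> affine_orbits Ks. S \<subseteq> b}" "d \<in> {b \<in> affine_orbits Ks. S \<subseteq> b}"
      and eq: "char_vector b = char_vector d"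
    have sub: "b \<subseteq> {..<17}" "d \<subseteq> {..<17}"
      using b affine_orbits_subset by blast+
    have mem: "0 \<in> b" "1 \<in> b" "0 \<in> d" "1 \<in> d"
      using b S by auto
    have "list_all2 (\<longrightarrow>) (char_vector b) (char_vector d)"
      "list_all2 (\<longrightarrow>) (char_vector d) (char_vector b)"
      using eq by (simp_all add: list_all2_same)
    then show "b = d"
      using sub mem by (simp add: list_all2_char_vector subset_antisym)
  qed
  then have "card {b \<in> affine_orbits Ks. S \<subseteq> b} = card (char_vector ` {b \<in> affine_orbits Ks. S \<subseteq> b})"
    by (simp add: card_image)
  also have "char_vector ` {b \<in> affine_orbits Ks. S \<subseteq> b} =
    set (filter (list_all2 (\<longrightarrow>) (char_vector S)) ?vs)"
  proof -
    have "list_all2 (\<longrightarrow>) (char_vector S) (char_vector b) \<longleftrightarrow> S \<subseteq> b"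
      if "0 \<in> b \<and> 1 \<in> b" for b
      using that S(1) by (simp only: list_all2_char_vector)
    moreover have "0 \<in> b \<and> 1 \<in> b" if "S \<subseteq> b" for b
      using that S(3,4) by blast
    ultimately show ?thesis
      by (simp only: set_filter dedup set_block_vectors[OF Ks]) blast
  qed
  also have "card \<dots> = length (filter (list_all2 (\<longrightarrow>) (char_vector S)) ?vs)"
    using dedup by (intro distinct_card) simp
  also have "\<dots> = l"
    using cov
  proof (rule covers_exactly_imp_length_filter)
    show "\<forall>v\<in>set ?vs. length v = 15"
      by (auto simp: dedup set_block_vectors[OF Ks] length_char_vector)
    show "count_list (char_vector S) True = k"
      using count_list_char_vector[OF S(1,3,4)] S(2) T(2) by simp
  qed (rule length_char_vector)
  finally show ?thesis using card by simp
qed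

section \<open>The design\<close>

definition base_blocks :: "int list list" where
  "base_blocks =
   [[0,1,2,3,4,5,6,11], [0,1,2,3,4,5,7,12], [0,2,3,4,5,6,7,10],
    [0,1,2,3,4,5,8,9], [0,3,4,5,6,7,8,11], [0,1,2,4,6,8,9,10],
    [0,1,2,3,4,6,7,9], [0,1,2,3,4,6,7,11], [0,1,2,3,4,6,8,9],
    [0,1,2,3,5,6,9,10], [0,1,4,5,6,7,8,10], [0,1,2,3,5,6,7,9],
    [0,1,3,4,5,7,9,10], [0,1,2,3,5,6,7,8], [0,1,2,5,7,8,9,11],
    [0,1,3,4,5,6,8,10], [0,1,4,5,6,8,9,11], [0,1,2,5,6,7,8,10]]"

lemma base_blocks_wf:
  "\<forall>K\<in>set base_blocks. distinct K \<and> length K = 8 \<and> set K \<subseteq> {0..16}"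
  by (simp add: base_blocks_def)

text \<open>The 3 is 5 minus the fixed points 0 and 1. The raw list has 18 * 8 * 7 = 1008 vectors,
  whereas a design with these parameters has 40 * 455 / 20 = 910 blocks through two points, so
  removing repetitions is essential.\<close>

lemma covers_exactly_base_blocks:
  "covers_exactly 40 15 3 (radix_dedup 15 (block_vectors base_blocks))"
  by code_simp

theorem theorem9:
  "\<exists>(P :: nat set) (B :: nat set multiset). t_design 5 17 8 40 P B \<and> simple_blocks B"
proof (intro exI conjI)
  let ?O = "affine_orbits base_blocks"
  have "card b = 8" if "b \<in> ?O" for b
    using that base_blocks_wf card_block by (fastforce simp: affine_orbits_def)
  moreover have "size {# b \<in># mset_set ?O. T \<subseteq> b #} = 40" if "T \<subseteq> {..<17}" "card T = 5" for T
  proof -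
    have "card {b \<in> ?O. T \<subseteq> b} = 40"
      using base_blocks_wf that
      by (intro card_blocks_containing[OF _ covers_exactly_base_blocks]) auto
    then show ?thesis
      by (simp add: filter_mset_mset_set finite_affine_orbits)
  qed
  ultimately show "t_design 5 17 8 40 {..<17} (mset_set ?O)"
    using affine_orbits_subset[of base_blocks]
    by (simp add: t_design_def finite_affine_orbits Pow_def subset_iff)
  show "simple_blocks (mset_set ?O)"
    by (simp add: simple_blocks_def count_mset_set')
qed

end
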